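(* Let $p_1<p_2$ be positive integers such that $\alpha=\frac{\log p_1}{\log p_2}$ is irrational, and let $S=\{p_1^ip_2^j\mid i,j\in\mathbb{N}\cup\{0\}\}=\{s_0=1<s_1<s_2<\cdots\}$. Let $\{a_0=0,a_1,a_2,\ldots\}$ be the simple continued fraction expansion of $\alpha$, let $h_0=0,k_0=1$, and let $\frac{h_i}{k_i}$ ($i\in\mathbb{N}$, $\gcd(h_i,k_i)=1$) be the sequence of primary convergents of $\alpha$. (1) For $i\ge 1$ and $0\le t<a_{2i+1}$, let $A_i^tB_i^tC_i^tD_i^t$ be the integer grid rectangle (of dimensions $h_{2i}\times k_{2i}$) with corners $$A_i^t=(k_{2i-1}+tk_{2i},\,0),\quad B_i^t=(k_{2i-1}+(t+1)k_{2i}-1,\,0),$$ $$C_i^t=(k_{2i-1}+(t+1)k_{2i}-1,\,h_{2i}-1),\quad D_i^t=(k_{2i-1}+tk_{2i},\,h_{2i}-1),$$ and let $\tilde A_i^t\tilde B_i^t\tilde C_i^t\tilde D_i^t$ be the integer grid rectangle (again of dimensions $h_{2i}\times k_{2i}$) with corners $$\tilde A_i^t=(0,\,h_{2i-1}+th_{2i}),\quad \tilde B_i^t=(k_{2i}-1,\,h_{2i-1}+th_{2i}),$$ $$\tilde C_i^t=(k_{2i}-1,\,h_{2i-1}+(t+1)h_{2i}-1),\quad \tilde D_i^t=(0,\,h_{2i-1}+(t+1)h_{2i}-1).$$ Then $\tilde A_i^t\tilde B_i^t\tilde C_i^t\tilde D_i^t=A_i^tB_i^tC_i^tD_i^t+(-k_{2i-1}-tk_{2i},\,h_{2i-1}+th_{2i})$,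 and for every point $v$ of $A_i^tB_i^tC_i^tD_i^t$ the translated point $v+(-k_{2i-1}-tk_{2i},\,h_{2i-1}+th_{2i})$ gives the co-ordinates of the next number in $S$ of the number with co-ordinates $v$. (2) For $i\ge 0$ and $0\le t<a_{2i+2}$, let $P_i^tQ_i^tR_i^tS_i^t$ be the integer grid rectangle (of dimensions $h_{2i+1}\times k_{2i+1}$) with corners $$P_i^t=(0,\,h_{2i}+th_{2i+1}),\quad Q_i^t=(k_{2i+1}-1,\,h_{2i}+th_{2i+1}),$$ $$R_i^t=(k_{2i+1}-1,\,h_{2i}+(t+1)h_{2i+1}-1),\quad S_i^t=(0,\,h_{2i}+(t+1)h_{2i+1}-1),$$ and let $\tilde P_i^t\tilde Q_i^t\tilde R_i^t\tilde S_i^t$ be the integer grid rectangle (again of dimensions $h_{2i+1}\times k_{2i+1}$) with corners $$\tilde P_i^t=(k_{2i}+tk_{2i+1},\,0),\quad \tilde Q_i^t=(k_{2i}+(t+1)k_{2i+1}-1,\,0),$$ $$\tilde R_i^t=(k_{2i}+(t+1)k_{2i+1}-1,\,h_{2i+1}-1),\quad \tilde S_i^t=(k_{2i}+tk_{2i+1},\,h_{2i+1}-1).$$ Then $\tilde P_i^t\tilde Q_i^t\tilde R_i^t\tilde S_i^t=P_i^tQ_i^tR_i^tS_i^t+(k_{2i}+tk_{2i+1},\,-h_{2i}-th_{2i+1})$, and for every point $v$ of $P_i^tQ_i^tR_i^tS_i^t$ the translated point $v+(k_{2i}+tk_{2i+1},\,-h_{2i}-th_{2i+1})$ gives the co-ordinates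 of the next number in $S$ of the number with co-ordinates $v$. (3) One has the disjoint union decompositions $$(\mathbb{N}\cup\{0\})\times(\mathbb{N}\cup\{0\})=\Big(\bigsqcup_{i\ge 1}\ \bigsqcup_{0\le t<a_{2i+1}}A_i^tB_i^tC_i^tD_i^t\Big)\ \sqcup\ \Big(\bigsqcup_{i\ge 0}\ \bigsqcup_{0\le t<a_{2i+2}}P_i^tQ_i^tR_i^tS_i^t\Big)$$ and $$\big((\mathbb{N}\cup\{0\})\times(\mathbb{N}\cup\{0\})\big)\setminus\{(0,0)\}=\Big(\bigsqcup_{i\ge 1}\ \bigsqcup_{0\le t<a_{2i+1}}\tilde A_i^t\tilde B_i^t\tilde C_i^t\tilde D_i^t\Big)\ \sqcup\ \Big(\bigsqcup_{i\ge 0}\ \bigsqcup_{0\le t<a_{2i+2}}\tilde P_i^t\tilde Q_i^t\tilde R_i^t\tilde S_i^t\Big).$$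
   Context: $\mathbb{N}=\{1,2,3,\ldots\}$. Since $\frac{\log p_1}{\log p_2}$ is irrational, every $n\in S$ is uniquely expressible as $n=p_1^ip_2^j$ with $i,j\in\mathbb{N}\cup\{0\}$; the pair $(i,j)$ is called the (non-negative integer) co-ordinates of $n$, and this gives a bijection of $S$ with $(\mathbb{N}\cup\{0\})\times(\mathbb{N}\cup\{0\})$. The next number of $s_k\in S$ is $s_{k+1}$, where $S=\{s_0<s_1<s_2<\cdots\}$ is listed in increasing order. The simple continued fraction expansion $\{a_0=0,a_1,a_2,\ldots\}$ of an irrational $\alpha\in[0,1]$ is $\alpha=a_0+\cfrac{1}{a_1+\cfrac{1}{a_2+\cdots}}$ with $a_i\in\mathbb{N}$ for $i\ge1$. The primary convergents are $\frac{h_0}{k_0}=\frac01$ and, for $i\in\mathbb{N}$, $\frac{h_i}{k_i}=a_0+\cfrac{1}{a_1+\cfrac{1}{\ddots+\cfrac{1}{a_i}}}$ in lowest terms ($k_i>0$, $\gcd(h_i,k_i)=1$); thus $h_1=1$, $k_1=a_1$, $h_{i+2}=a_{i+2}h_{i+1}+h_i$, $k_{i+2}=a_{i+2}k_{i+1}+k_i$. The integer grid rectangle with corners $(x_0,y_0),(x_1,y_0),(x_1,y_1),(x_0,y_1)$, where $x_0\le x_1$ and $y_0\le y_1$ are integers, is the set of all integer points $(x,y)$ with $x_0\le x\le x_1$, $y_0\le y\le y_1$; "dimensions $h\times k$" means that it has $h$ distinct second co-ordinates and $k$ distinct first co-ordinates. The translate of a set of points by a vector is the set of all points translated by this vector.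 *)

theory Defs
  imports "HOL-Analysis.Analysis"
begin

text \<open>\<open>fin_cf a n\<close> is the finite continued fraction
  \<open>a 0 + 1 / (a 1 + 1 / (\<dots> + 1 / a n))\<close>; the recursion shifts the sequence by one.\<close>

fun fin_cf :: "(nat \<Rightarrow> int) \<Rightarrow> nat \<Rightarrow> real" where
  "fin_cf a 0 = real_of_int (a 0)"
| "fin_cf a (Suc n) = real_of_int (a 0) + 1 / fin_cf (\<lambda>i. a (Suc i)) n"

text \<open>Simple continued fraction expansion of an irrational number in the unit interval,
  so that the integer part \<open>a 0\<close> vanishes.  The infinite continued fraction is the limit of
  the finite ones.\<close>

definition simple_cf_expansion :: "real \<Rightarrow> (nat \<Rightarrow> int) \<Rightarrow> bool" where
  "simple_cf_expansion \<alpha> a \<longleftrightarrow>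
     a 0 = 0 \<and> (\<forall>i\<ge>1. a i \<ge> 1) \<and> fin_cf a \<longlonglongrightarrow> \<alpha>"

definition primary_convergents :: "(nat \<Rightarrow> int) \<Rightarrow> (nat \<Rightarrow> int) \<Rightarrow> (nat \<Rightarrow> int) \<Rightarrow> bool" where
  "primary_convergents a h k \<longleftrightarrow>
     h 0 = 0 \<and> k 0 = 1 \<and>
     (\<forall>i\<ge>1. k i > 0 \<and> coprime (h i) (k i) \<and> real_of_int (h i) / real_of_int (k i) = fin_cf a i)"

definition numS :: "nat \<Rightarrow> nat \<Rightarrow> nat set" where
  "numS p1 p2 = {p1 ^ i * p2 ^ j | i j. True}"

text \<open>Points are pairs of integers, since they get translated by vectors with negative
  components.  Only points with non-negative components are co-ordinates of a number.\<close>

definition is_coords :: "nat \<Rightarrow> nat \<Rightarrow> int \<times> int \<Rightarrow> nat \<Rightarrow> bool" where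
  "is_coords p1 p2 v n \<longleftrightarrow>
     fst v \<ge> 0 \<and> snd v \<ge> 0 \<and> n = p1 ^ nat (fst v) * p2 ^ nat (snd v)"

text \<open>\<open>enumerate S\<close> lists an infinite set \<open>S\<close> of naturals increasingly, starting at index \<open>0\<close>.\<close>

definition next_in :: "nat set \<Rightarrow> nat \<Rightarrow> nat \<Rightarrow> bool" where
  "next_in S m n \<longleftrightarrow> (\<exists>l. m = enumerate S l \<and> n = enumerate S (Suc l))"

text \<open>The rectangle with corners \<open>(x0, y0)\<close>, \<open>(x1, y0)\<close>, \<open>(x1, y1)\<close>, \<open>(x0, y1)\<close>.\<close>

definition grid_rect :: "int \<Rightarrow> int \<Rightarrow> int \<Rightarrow> int \<Rightarrow> (int \<times> int) set" where
  "grid_rect x0 x1 y0 y1 = {(x, y). x0 \<le> x \<and> x \<le> x1 \<and> y0 \<le> y \<and> y \<le> y1}"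

text \<open>Dimensions \<open>m \<times> n\<close>: the first number counts second co-ordinates (rows).\<close>

definition has_dims :: "(int \<times> int) set \<Rightarrow> int \<Rightarrow> int \<Rightarrow> bool" where
  "has_dims R m n \<longleftrightarrow> finite R \<and> int (card (snd ` R)) = m \<and> int (card (fst ` R)) = n"

definition translate :: "(int \<times> int) set \<Rightarrow> int \<times> int \<Rightarrow> (int \<times> int) set" where
  "translate R w = (\<lambda>v. v + w) ` R"

definition rectA :: "(nat \<Rightarrow> int) \<Rightarrow> (nat \<Rightarrow> int) \<Rightarrow> nat \<Rightarrow> int \<Rightarrow> (int \<times> int) set" where
  "rectA h k i t =
     grid_rect (k (2*i-1) + t * k (2*i)) (k (2*i-1) + (t+1) * k (2*i) - 1) 0 (h (2*i) - 1)"

definition rectA_tilde :: "(nat \<Rightarrow> int) \<Rightarrow> (nat \<Rightarrow> int) \<Rightarrow> nat \<Rightarrow> int \<Rightarrow> (int \<times> int) set" where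
  "rectA_tilde h k i t =
     grid_rect 0 (k (2*i) - 1) (h (2*i-1) + t * h (2*i)) (h (2*i-1) + (t+1) * h (2*i) - 1)"

definition rectP :: "(nat \<Rightarrow> int) \<Rightarrow> (nat \<Rightarrow> int) \<Rightarrow> nat \<Rightarrow> int \<Rightarrow> (int \<times> int) set" where
  "rectP h k i t =
     grid_rect 0 (k (2*i+1) - 1) (h (2*i) + t * h (2*i+1)) (h (2*i) + (t+1) * h (2*i+1) - 1)"

definition rectP_tilde :: "(nat \<Rightarrow> int) \<Rightarrow> (nat \<Rightarrow> int) \<Rightarrow> nat \<Rightarrow> int \<Rightarrow> (int \<times> int) set" where
  "rectP_tilde h k i t =
     grid_rect (k (2*i) + t * k (2*i+1)) (k (2*i) + (t+1) * k (2*i+1) - 1) 0 (h (2*i+1) - 1)"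

definition indexA :: "(nat \<Rightarrow> int) \<Rightarrow> (nat \<times> int) set" where
  "indexA a = {(i, t). 1 \<le> i \<and> 0 \<le> t \<and> t < a (2*i+1)}"

definition indexP :: "(nat \<Rightarrow> int) \<Rightarrow> (nat \<times> int) set" where
  "indexP a = {(i, t). 0 \<le> t \<and> t < a (2*i+2)}"

text \<open>\<open>X\<close> is the disjoint union of all members of the two indexed families \<open>F\<close> and \<open>G\<close>.\<close>

definition is_disjoint_union2 ::
    "'c set \<Rightarrow> 'a set \<Rightarrow> ('a \<Rightarrow> 'c set) \<Rightarrow> 'b set \<Rightarrow> ('b \<Rightarrow> 'c set) \<Rightarrow> bool" where
  "is_disjoint_union2 X I F J G \<longleftrightarrow>
     X = (\<Union>i\<in>I. F i) \<union> (\<Union>j\<in>J. G j) \<and>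
     disjoint_family_on F I \<and> disjoint_family_on G J \<and>
     (\<Union>i\<in>I. F i) \<inter> (\<Union>j\<in>J. G j) = {}"

end

(* The numbers p1^x * p2^y are ordered by the linear form x * ln p1 + y * ln p2 on the
   quadrant.  The vectors (k_n, -h_n) and (k_{n-1} + t k_n, -h_{n-1} - t h_n) form a basis of
   the integer lattice, and since the convergents alternate around the quotient of the
   logarithms, the form takes opposite signs on them.  Replace both by plus or minus
   themselves so that the form is positive, and write the difference of two points in this
   basis.  If both coefficients are nonnegative and the second is not 0, the difference is at
   least the claimed step.  Otherwise a positive difference has a positive first and a
   nonpositive second coefficient, or a negative first and a positive second one, and either
   move leaves the quadrant when it starts in the given rectangle.
   The rectangles tile the quadrant because, with t running, they fill up strips attached
   alternately on top of and to the right of a growing rectangle at the origin. *)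
theory Submission
  imports Defs
begin

section \<open>Continuants\<close>

text \<open>Classical three-term recurrence, which extends the fraction at its tail, whereas
  \<open>fin_cf\<close> peels off its head. The two shift lemmas below bridge the gap.\<close>

fun cf_num :: "(nat \<Rightarrow> int) \<Rightarrow> nat \<Rightarrow> int" where
  "cf_num a 0 = a 0"
| "cf_num a (Suc 0) = a 0 * a 1 + 1"
| "cf_num a (Suc (Suc n)) = a (Suc (Suc n)) * cf_num a (Suc n) + cf_num a n"

fun cf_den :: "(nat \<Rightarrow> int) \<Rightarrow> nat \<Rightarrow> int" where
  "cf_den a 0 = 1"
| "cf_den a (Suc 0) = a 1"
| "cf_den a (Suc (Suc n)) = a (Suc (Suc n)) * cf_den a (Suc n) + cf_den a n"

text \<open>Both sides obey the same recurrence and agree for the first two indices.\<close>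

lemma cf_den_Suc_shift: "cf_den a (Suc n) = cf_num (\<lambda>i. a (Suc i)) n"
  by (induction a n rule: cf_num.induct) (simp_all add: mult.commute)

lemma cf_num_Suc_shift:
  "cf_num a (Suc n) = a 0 * cf_num (\<lambda>i. a (Suc i)) n + cf_den (\<lambda>i. a (Suc i)) n"
  by (induction a n rule: cf_num.induct) (simp_all add: algebra_simps)

lemma cf_den_pos:
  assumes "\<And>i. i \<ge> 1 \<Longrightarrow> a i \<ge> 1"
  shows "cf_den a n > 0"
  using assms
proof (induction a n rule: cf_den.induct)
  case (2 a)
  from "2.prems"[of 1] show ?case by simp
next
  case (3 a n)
  have "a (Suc (Suc n)) \<ge> 1" by (rule "3.prems") simp
  moreover have "cf_den a (Suc n) > 0" using 3 by simp
  ultimately have "a (Suc (Suc n)) * cf_den a (Suc n) > 0" by (intro mult_pos_pos) auto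
  with 3 show ?case by simp
qed simp

lemma fin_cf_eq:
  assumes "\<And>i. i \<ge> 1 \<Longrightarrow> a i \<ge> 1"
  shows "fin_cf a n = of_int (cf_num a n) / of_int (cf_den a n)"
  using assms
proof (induction n arbitrary: a)
  case (Suc n)
  let ?b = "\<lambda>i. a (Suc i)"
  have "fin_cf ?b n = of_int (cf_num ?b n) / of_int (cf_den ?b n)"
    by (rule Suc.IH) (simp add: Suc.prems)
  \<comment> \<open>This numerator is the denominator of the unshifted fraction. Its positivity
    keeps the reciprocal in \<open>fin_cf\<close> away from division by zero.\<close>
  moreover have "cf_num ?b n > 0"
    using cf_den_pos[of a "Suc n"] Suc.prems by (simp add: cf_den_Suc_shift)
  ultimately show ?case
    by (simp add: cf_num_Suc_shift cf_den_Suc_shift field_simps)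
qed simp

text \<open>One step of the recurrence only flips the sign of the determinant. Neighbouring
  convergents therefore span the integer lattice.\<close>

lemma cf_det: "cf_num a (Suc n) * cf_den a n - cf_num a n * cf_den a (Suc n) = (-1) ^ n"
  by (induction n) (simp_all add: algebra_simps)

lemma coprime_cf: "coprime (cf_num a n) (cf_den a n)"
proof (rule coprimeI)
  fix c assume "c dvd cf_num a n" "c dvd cf_den a n"
  hence "c dvd cf_num a (Suc n) * cf_den a n - cf_num a n * cf_den a (Suc n)"
    by (intro dvd_diff) auto
  thus "is_unit c"
    unfolding cf_det by (metis dvd_trans minus_one_power_iff dvd_minus_iff dvd_refl)
qed

lemma reduced_fraction_eqD:
  fixes p q r s :: int
  assumes "q > 0" "s > 0" "coprime p q" "coprime r s"
    and "real_of_int p / of_int q = of_int r / of_int s"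
  shows "p = r" "q = s"
proof -
  have "real_of_int (p * s) = of_int (r * q)"
    using assms by (simp add: field_simps)
  hence eq: "p * s = r * q" by linarith
  have "q dvd s" "s dvd q"
    using eq assms(3,4) by (metis coprime_commute coprime_dvd_mult_right_iff dvd_triv_right)+
  thus "q = s" using assms(1,2) by (simp add: zdvd_antisym_nonneg)
  with eq assms show "p = r" by simp
qed

text \<open>The difference of convergents two apart has the sign of \<open>(-1) ^ n\<close>, so the
  even ones increase to \<alpha> and the odd ones decrease to it.\<close>

lemma cf_even_below_odd_above:
  assumes a: "\<And>i. i \<ge> 1 \<Longrightarrow> a i \<ge> 1" and lim: "fin_cf a \<longlonglongrightarrow> \<alpha>"
  shows "of_int (cf_num a (2*n)) < \<alpha> * of_int (cf_den a (2*n))"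
    and "\<alpha> * of_int (cf_den a (2*n+1)) < of_int (cf_num a (2*n+1))"
proof -
  let ?c = "fin_cf a" and ?K = "\<lambda>n. real_of_int (cf_den a n)"
  have K: "?K n > 0" for n using cf_den_pos[OF a] by simp
  have step: "?c (Suc (Suc n)) - ?c n
    = of_int (a (Suc (Suc n))) * (-1) ^ n / (?K n * ?K (Suc (Suc n)))" for n
  proof -
    have "cf_num a (Suc (Suc n)) * cf_den a n - cf_num a n * cf_den a (Suc (Suc n))
      = a (Suc (Suc n)) * (cf_num a (Suc n) * cf_den a n - cf_num a n * cf_den a (Suc n))"
      by (simp add: algebra_simps)
    also have "\<dots> = a (Suc (Suc n)) * (-1) ^ n" by (simp only: cf_det)
    finally have "real_of_int (cf_num a (Suc (Suc n)) * cf_den a n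
        - cf_num a n * cf_den a (Suc (Suc n))) = of_int (a (Suc (Suc n)) * (-1) ^ n)"
      by (simp only:)
    thus ?thesis using K[of n] K[of "Suc (Suc n)"]
      by (simp add: fin_cf_eq[OF a] field_simps del: fin_cf.simps cf_num.simps cf_den.simps)
  qed
  have a_pos: "real_of_int (a (Suc (Suc n))) > 0" for n using a[of "Suc (Suc n)"] by simp
  have even_less: "?c (2*n) < ?c (2 * Suc n)" for n
  proof -
    have "?c (Suc (Suc (2*n))) - ?c (2*n) > 0"
      unfolding step using K[of "2*n"] K[of "Suc (Suc (2*n))"] a_pos[of "2*n"]
      by (simp del: cf_num.simps cf_den.simps)
    thus ?thesis by simp
  qed
  have odd_less: "?c (2 * Suc n + 1) < ?c (2*n + 1)" for n
  proof -
    have "?c (Suc (Suc (2*n+1))) - ?c (2*n+1) < 0"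
      unfolding step using K[of "2*n+1"] K[of "Suc (Suc (2*n+1))"] a_pos[of "2*n+1"]
      by (simp add: divide_less_0_iff del: cf_num.simps cf_den.simps)
    thus ?thesis by simp
  qed
  have lim_even: "(\<lambda>n. ?c (2*n)) \<longlonglongrightarrow> \<alpha>"
    using LIMSEQ_subseq_LIMSEQ[OF lim, of "\<lambda>n. 2*n"] by (simp add: strict_mono_def o_def)
  have lim_odd: "(\<lambda>n. ?c (2*n+1)) \<longlonglongrightarrow> \<alpha>"
    using LIMSEQ_subseq_LIMSEQ[OF lim, of "\<lambda>n. 2*n+1"] by (simp add: strict_mono_def o_def)
  \<comment> \<open>The limit yields only a weak bound, so it is taken one term later; strict
    monotonicity then makes the bound strict at \<open>2*n\<close>.\<close>
  have "?c (2 * Suc n) \<le> \<alpha>"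
    by (rule incseq_le[OF incseq_SucI lim_even]) (rule less_imp_le[OF even_less])
  with even_less[of n] have "?c (2*n) < \<alpha>" by simp
  thus "of_int (cf_num a (2*n)) < \<alpha> * of_int (cf_den a (2*n))"
    using K[of "2*n"] by (simp add: fin_cf_eq[OF a] divide_less_eq)
  have "\<alpha> \<le> ?c (2 * Suc n + 1)"
    by (rule decseq_ge[OF decseq_SucI lim_odd]) (rule less_imp_le[OF odd_less])
  with odd_less[of n] have "\<alpha> < ?c (2*n+1)" by simp
  thus "\<alpha> * of_int (cf_den a (2*n+1)) < of_int (cf_num a (2*n+1))"
    using K[of "2*n+1"]
    by (simp add: fin_cf_eq[OF a] less_divide_eq del: fin_cf.simps cf_num.simps cf_den.simps)
qed

text \<open>For positive indices both pairs are reduced fractions of equal value with positive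
  denominators; index 0 agrees because \<open>a 0 = 0\<close>. This transfers recurrence and
  determinant to \<open>h\<close> and \<open>k\<close>.\<close>

lemma primary_convergents_eq_cf:
  assumes exp: "simple_cf_expansion \<alpha> a" and conv: "primary_convergents a h k"
  shows "h n = cf_num a n" "k n = cf_den a n"
proof -
  from exp have a0: "a 0 = 0" and a: "\<And>i. i \<ge> 1 \<Longrightarrow> a i \<ge> 1"
    by (auto simp: simple_cf_expansion_def)
  have "h n = cf_num a n \<and> k n = cf_den a n"
  proof (cases "n = 0")
    case True
    with conv a0 show ?thesis by (simp add: primary_convergents_def)
  next
    case False
    with conv have "k n > 0" "coprime (h n) (k n)"
      "real_of_int (h n) / of_int (k n) = of_int (cf_num a n) / of_int (cf_den a n)"
      by (auto simp: primary_convergents_def fin_cf_eq[OF a])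
    with reduced_fraction_eqD[of "k n" "cf_den a n" "h n" "cf_num a n"] coprime_cf cf_den_pos[of a n, OF a]
    show ?thesis by blast
  qed
  thus "h n = cf_num a n" "k n = cf_den a n" by auto
qed

section \<open>Consecutive elements\<close>

lemma next_inI:
  assumes "infinite S" "m \<in> S" "n \<in> S" "m < n" "\<And>s. s \<in> S \<Longrightarrow> m < s \<Longrightarrow> n \<le> s"
  shows "next_in S m n"
proof -
  obtain l where l: "enumerate S l = m"
    using enumerate_Ex[OF assms(1,2)] by blast
  have "enumerate S (Suc l) = n"
    unfolding enumerate_Suc''[OF assms(1)] l
    using assms(3-5) by (intro Least_equality) auto
  with l show ?thesis by (auto simp: next_in_def)
qed

lemma infinite_numS:
  assumes "1 < p1" "1 < p2"
  shows "infinite (numS p1 p2)"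
proof -
  have "inj ((^) p1)" using assms by (auto intro: injI simp: power_inject_exp)
  hence "infinite (range ((^) p1))" by (simp add: range_inj_infinite)
  moreover have "range ((^) p1) \<subseteq> numS p1 p2"
    unfolding numS_def by clarsimp (metis mult.right_neutral power_0)
  ultimately show ?thesis by (metis finite_subset)
qed

lemma in_numS_iff: "n \<in> numS p1 p2 \<longleftrightarrow> (\<exists>x y. is_coords p1 p2 (x, y) n)"
proof
  assume "n \<in> numS p1 p2"
  then obtain i j where "n = p1 ^ i * p2 ^ j" by (auto simp: numS_def)
  hence "is_coords p1 p2 (int i, int j) n" by (simp add: is_coords_def)
  thus "\<exists>x y. is_coords p1 p2 (x, y) n" by blast
qed (auto simp: is_coords_def numS_def)

text \<open>Together with \<open>is_coords_swap\<close> this is the symmetry that lets one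
  translation result serve both families of rectangles.\<close>

lemma numS_commute: "numS p2 p1 = numS p1 p2"
  by (auto simp: numS_def) (metis mult.commute)+

lemma is_coords_swap: "is_coords p2 p1 (y, x) = is_coords p1 p2 (x, y)"
  by (auto simp: is_coords_def fun_eq_iff mult.commute)

lemma ln_is_coords:
  assumes "is_coords p1 p2 (x, y) n" "0 < p1" "0 < p2"
  shows "n > 0" "ln (real n) = of_int x * ln (real p1) + of_int y * ln (real p2)"
  using assms by (auto simp: is_coords_def ln_mult ln_realpow)

text \<open>The linear form is positive on both basis vectors \<open>(k, - h)\<close> and \<open>(- K, H)\<close>; the
  coefficients of \<open>(x' - x, y' - y)\<close> with respect to them are \<open>m\<close> and \<open>n\<close> below.\<close>

lemma translate_le_of_gt:
  fixes x y x' y' h k H K :: int and A B :: real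
  assumes det: "H * k - h * K = 1"
    and nonneg: "0 \<le> H" "0 \<le> K" "0 \<le> h" "0 \<le> k" "0 \<le> x'" "0 \<le> y'"
    and start: "x < K + k" "y < h"
    and pos1: "of_int h * B < of_int k * A" and pos2: "of_int K * A < of_int H * B"
    and gt: "of_int x * A + of_int y * B < of_int x' * A + of_int y' * B"
  shows "of_int (x - K) * A + of_int (y + H) * B \<le> of_int x' * A + of_int y' * B"
proof -
  define m where "m = (x' - x) * H + (y' - y) * K"
  define n where "n = (x' - x) * h + (y' - y) * k"
  \<comment> \<open>Cramer's rule: as the determinant is 1, the integers \<open>m\<close> and
    \<open>n\<close> recover the difference of the points.\<close>
  have "m * k - n * K = (x' - x) * (H * k - h * K)"
    by (simp add: m_def n_def algebra_simps)
  hence d: "x' - x = m * k - n * K" using det by simp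
  have "n * H - m * h = (y' - y) * (H * k - h * K)"
    by (simp add: m_def n_def algebra_simps)
  hence e: "y' - y = n * H - m * h" using det by simp
  define u where "u = of_int k * A - of_int h * B"
  define v where "v = of_int H * B - of_int K * A"
  have uv: "u > 0" "v > 0" using pos1 pos2 by (auto simp: u_def v_def)
  have diff: "(of_int x' * A + of_int y' * B) - (of_int x * A + of_int y * B)
      = of_int m * u + of_int n * v"
  proof -
    have "(of_int x' * A + of_int y' * B) - (of_int x * A + of_int y * B)
        = of_int (x' - x) * A + of_int (y' - y) * B" by (simp add: algebra_simps)
    also have "\<dots> = of_int m * u + of_int n * v"
      unfolding d e u_def v_def by (simp add: algebra_simps)
    finally show ?thesis .
  qed
  have mn_pos: "of_int m * u + of_int n * v > 0" using diff gt by simp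
  \<comment> \<open>If \<open>n \<le> 0\<close>, positivity of the form forces
    \<open>m \<ge> 1\<close>; then \<open>y' - y \<le> - h\<close>, which contradicts
    \<open>y < h\<close> and \<open>0 \<le> y'\<close>.\<close>
  have "n \<ge> 1"
  proof (rule ccontr)
    assume "\<not> n \<ge> 1"
    hence n: "n \<le> 0" by simp
    hence "of_int n * v \<le> 0" using uv by (simp add: mult_nonpos_nonneg)
    hence "of_int m * u > 0" using mn_pos by linarith
    hence "m \<ge> 1" using uv by (simp add: zero_less_mult_iff)
    hence "1 * h \<le> m * h" using nonneg by (intro mult_right_mono) auto
    moreover have "n * H \<le> 0" using n nonneg by (simp add: mult_nonpos_nonneg)
    ultimately show False using e start nonneg by linarith
  qed
  \<comment> \<open>Given \<open>n \<ge> 1\<close>, a negative \<open>m\<close> would yield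
    \<open>x' - x \<le> - k - K\<close>, contradicting \<open>x < K + k\<close> and
    \<open>0 \<le> x'\<close>.\<close>
  moreover have "m \<ge> 0"
  proof (rule ccontr)
    assume "\<not> m \<ge> 0"
    hence "m * k \<le> (-1) * k" using nonneg by (intro mult_right_mono) auto
    moreover have "1 * K \<le> n * K" using \<open>n \<ge> 1\<close> nonneg by (intro mult_right_mono) auto
    ultimately show False using d start nonneg by linarith
  qed
  ultimately have "1 * v \<le> of_int n * v" "0 \<le> of_int m * u"
    using uv by (auto intro: mult_right_mono simp del: mult_1)
  hence "v \<le> (of_int x' * A + of_int y' * B) - (of_int x * A + of_int y * B)"
    using diff by linarith
  thus ?thesis by (simp add: v_def algebra_simps)
qed

text \<open>The logarithm turns the order on the numbers into the order of the linear form, where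
  the previous lemma gives minimality. No order between \<open>p1\<close> and \<open>p2\<close> is
  fixed, so they can be exchanged.\<close>

lemma next_in_numS_translate:
  fixes p1 p2 :: nat and x y h k H K :: int
  assumes p: "1 < p1" "1 < p2"
    and det: "H * k - h * K = 1"
    and nonneg: "0 \<le> H" "0 \<le> K" "0 \<le> h" "0 \<le> k"
    and x: "K \<le> x" "x < K + k" and y: "0 \<le> y" "y < h"
    and pos1: "of_int h * ln (real p2) < of_int k * ln (real p1)"
    and pos2: "of_int K * ln (real p1) < of_int H * ln (real p2)"
  shows "\<exists>m n. is_coords p1 p2 (x, y) m \<and> next_in (numS p1 p2) m n \<and>
           is_coords p1 p2 (x - K, y + H) n"
proof -
  define m where "m = p1 ^ nat x * p2 ^ nat y"
  define n where "n = p1 ^ nat (x - K) * p2 ^ nat (y + H)"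
  have m: "is_coords p1 p2 (x, y) m" and n: "is_coords p1 p2 (x - K, y + H) n"
    using nonneg x y by (auto simp: is_coords_def m_def n_def)
  have p0: "0 < p1" "0 < p2" using p by auto
  note lm = ln_is_coords[OF m p0] and ln = ln_is_coords[OF n p0]
  have "next_in (numS p1 p2) m n"
  proof (rule next_inI)
    show "infinite (numS p1 p2)" by (rule infinite_numS[OF p])
    show "m \<in> numS p1 p2" "n \<in> numS p1 p2" using m n in_numS_iff by blast+
    have "ln (real m) < ln (real n)"
      using pos2 unfolding lm(2) ln(2) by (simp add: algebra_simps)
    thus "m < n" using lm(1) ln(1) by simp
  next
    fix s assume "s \<in> numS p1 p2" "m < s"
    then obtain x' y' where s: "is_coords p1 p2 (x', y') s" using in_numS_iff by blast
    note ls = ln_is_coords[OF s p0]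
    have nn: "0 \<le> x'" "0 \<le> y'" using s by (auto simp: is_coords_def)
    have "ln (real m) < ln (real s)" using \<open>m < s\<close> lm(1) by simp
    hence "ln (real n) \<le> ln (real s)"
      unfolding lm(2) ln(2) ls(2)
      using translate_le_of_gt[OF det nonneg nn x(2) y(2) pos1 pos2] by blast
    thus "n \<le> s" using ln(1) ls(1) by simp
  qed
  with m n show ?thesis by blast
qed

section \<open>Grid rectangles and tilings\<close>

lemma grid_rect_eq_Times: "grid_rect x0 x1 y0 y1 = {x0..x1} \<times> {y0..y1}"
  by (auto simp: grid_rect_def)

lemma swap_grid_rect: "prod.swap ` grid_rect x0 x1 y0 y1 = grid_rect y0 y1 x0 x1"
  by (simp add: grid_rect_eq_Times product_swap)

lemma has_dims_grid_rect:
  assumes "0 < m" "0 < n" "x1 = x0 + n - 1" "y1 = y0 + m - 1"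
  shows "has_dims (grid_rect x0 x1 y0 y1) m n"
  using assms by (simp add: has_dims_def grid_rect_eq_Times)

lemma translate_grid_rect:
  "translate (grid_rect x0 x1 y0 y1) (c, d) = grid_rect (x0 + c) (x1 + c) (y0 + d) (y1 + d)"
proof -
  have "p \<in> translate (grid_rect x0 x1 y0 y1) (c, d)"
    if "p \<in> grid_rect (x0 + c) (x1 + c) (y0 + d) (y1 + d)" for p
    unfolding translate_def
    by (rule image_eqI[of _ _ "(fst p - c, snd p - d)"]) (use that in \<open>auto simp: grid_rect_def\<close>)
  thus ?thesis by (auto simp: translate_def grid_rect_def)
qed

text \<open>Injective images preserve disjointness; this serves to reflect a tiling in the
  diagonal.\<close>

lemma is_disjoint_union2_image:
  assumes "is_disjoint_union2 X I F J G" "inj f"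
  shows "is_disjoint_union2 (f ` X) I (\<lambda>i. f ` F i) J (\<lambda>j. f ` G j)"
  using assms unfolding is_disjoint_union2_def disjoint_family_on_def
  by (simp add: image_Un image_UN image_Int[symmetric] flip: image_UN)

lemma is_disjoint_union2_cong:
  assumes "X = X'" "\<And>i. i \<in> I \<Longrightarrow> F i = F' i" "\<And>j. j \<in> J \<Longrightarrow> G j = G' j"
  shows "is_disjoint_union2 X I F J G = is_disjoint_union2 X' I F' J G'"
  using assms unfolding is_disjoint_union2_def disjoint_family_on_def by simp

lemma int_strict_mono_interval_ex:
  fixes u :: "nat \<Rightarrow> int"
  assumes mono: "\<And>i. i \<ge> r \<Longrightarrow> u i < u (Suc i)" and "u r \<le> z"
  shows "\<exists>i\<ge>r. u i \<le> z \<and> z < u (Suc i)"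
proof -
  have grow: "u r + int j \<le> u (r + j)" for j
  proof (induction j)
    case (Suc j)
    with mono[of "r + j"] show ?case by simp
  qed simp
  \<comment> \<open>Each step gains at least 1, so \<open>z - u r + 1\<close> steps from
    \<open>r\<close> pass \<open>z\<close>.\<close>
  have "\<exists>i\<ge>r. z < u (Suc i)"
    using grow[of "Suc (nat (z - u r))"] assms(2)
    by (intro exI[of _ "r + nat (z - u r)"]) auto
  then obtain i where "i \<ge> r \<and> z < u (Suc i)"
    and least: "\<And>j. j < i \<Longrightarrow> \<not> (j \<ge> r \<and> z < u (Suc j))"
    unfolding exists_least_iff[of "\<lambda>i. i \<ge> r \<and> z < u (Suc i)"] by blast
  hence i: "i \<ge> r" "z < u (Suc i)" by auto
  \<comment> \<open>Beyond \<open>r\<close>, minimality of \<open>i\<close> excludes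
    \<open>z < u i\<close>, which would make \<open>i - 1\<close> a smaller candidate.\<close>
  have "u i \<le> z"
  proof (cases "i = r")
    case False
    with i have "i - 1 < i" "i - 1 \<ge> r" "Suc (i - 1) = i" by auto
    with least[of "i - 1"] show ?thesis by auto
  qed (use assms in simp)
  with i show ?thesis by blast
qed

text \<open>Division with remainder: the quotient of \<open>z - u\<close> by \<open>c\<close>
  indexes the piece containing \<open>z\<close>. With the next two lemmas, \<open>n\<close> pieces
  of length \<open>c\<close> partition the interval from \<open>u\<close> up to
  \<open>u + n * c\<close>, right end excluded.\<close>

lemma subdivision_ex:
  fixes z c n u :: int
  assumes "0 < c" "u \<le> z" "z < u + n * c"
  shows "\<exists>t. 0 \<le> t \<and> t < n \<and> u + t * c \<le> z \<and> z \<le> u + (t + 1) * c - 1"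
proof (intro exI[of _ "(z - u) div c"] conjI)
  have eq: "z - u = (z - u) div c * c + (z - u) mod c" by simp
  have r: "0 \<le> (z - u) mod c" "(z - u) mod c < c" using assms by auto
  show "0 \<le> (z - u) div c" using assms by (simp add: pos_imp_zdiv_nonneg_iff)
  show "u + (z - u) div c * c \<le> z" using eq r by linarith
  show "z \<le> u + ((z - u) div c + 1) * c - 1"
    using eq r unfolding distrib_right by linarith
  have "(z - u) div c * c < n * c" using eq r assms by linarith
  thus "(z - u) div c < n" using assms by simp
qed

lemma subdivision_unique:
  fixes z c t s u :: int
  assumes "0 < c" "u + t * c \<le> z" "z \<le> u + (t + 1) * c - 1" "u + s * c \<le> z" "z \<le> u + (s + 1) * c - 1"
  shows "t = s"
proof -
  have "t * c < (s + 1) * c" "s * c < (t + 1) * c" using assms by linarith+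
  thus ?thesis using assms(1) by simp
qed

lemma subdivision_bounds:
  fixes z c n t u :: int
  assumes "0 < c" "0 \<le> t" "t < n" "u + t * c \<le> z" "z \<le> u + (t + 1) * c - 1"
  shows "u \<le> z" "z < u + n * c"
proof -
  have "0 \<le> t * c" "(t + 1) * c \<le> n * c" using assms by (auto intro: mult_right_mono)
  thus "u \<le> z" "z < u + n * c" using assms by linarith+
qed

text \<open>Starting from \<open>{0..<x 1} \<times> {0..<y 0}\<close>, strips are attached alternately on top
  (family \<open>G\<close>) and to the right (family \<open>F\<close>); each strip is cut into \<open>n i\<close> or \<open>m i\<close>
  pieces.  The sequence \<open>x\<close> is indexed from \<open>1\<close>.\<close>

lemma staircase_tiling:
  fixes x y c d m n :: "nat \<Rightarrow> int"
  assumes c: "\<And>i. 0 < c i" and d: "\<And>i. i \<ge> 1 \<Longrightarrow> 0 < d i"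
    and m: "\<And>i. i \<ge> 1 \<Longrightarrow> 0 < m i" and n: "\<And>i. 0 < n i"
    and x1: "0 \<le> x 1" and y0: "0 \<le> y 0"
    and x_Suc: "\<And>i. i \<ge> 1 \<Longrightarrow> x (Suc i) = x i + m i * d i"
    and y_Suc: "\<And>i. y (Suc i) = y i + n i * c i"
  defines "F \<equiv> \<lambda>(i, t). grid_rect (x i + t * d i) (x i + (t + 1) * d i - 1) 0 (y i - 1)"
    and "G \<equiv> \<lambda>(i, t). grid_rect 0 (x (Suc i) - 1) (y i + t * c i) (y i + (t + 1) * c i - 1)"
  shows "is_disjoint_union2 ({0..} \<times> {0..} - {0..<x 1} \<times> {0..<y 0})
    {(i, t). 1 \<le> i \<and> 0 \<le> t \<and> t < m i} F {(i, t). 0 \<le> t \<and> t < n i} G"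
    (is "is_disjoint_union2 ?X ?I F ?J G")
proof -
  have x_less: "x i < x (Suc i)" if "i \<ge> 1" for i using that x_Suc[of i] d m by simp
  have y_less: "y i < y (Suc i)" for i using y_Suc[of i] c n by simp
  have x_mono: "x i \<le> x j" if "1 \<le> i" "i \<le> j" for i j
    using that(2,1)
  proof (induction j rule: dec_induct)
    case (step k)
    with x_less[of k] show ?case by simp
  qed simp
  have y_mono: "y i \<le> y j" if "i \<le> j" for i j
    using lift_Suc_mono_le[of y, OF less_imp_le[OF y_less] that] .
  \<comment> \<open>\<open>F\<close> and \<open>G\<close> bound each piece by its whole strip,
    \<open>F_ex\<close> and \<open>G_ex\<close> find the piece within a strip; \<open>t\<close> then
    plays no part in comparing strips.\<close>
  have F: "x i \<le> a \<and> a < x (Suc i) \<and> 0 \<le> b \<and> b < y i"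
    if "(a, b) \<in> F (i, t)" "(i, t) \<in> ?I" for a b i t
    using that subdivision_bounds[of "d i" t "m i" "x i" a] d[of i] x_Suc[of i]
    by (auto simp: F_def grid_rect_def)
  have G: "0 \<le> a \<and> a < x (Suc i) \<and> y i \<le> b \<and> b < y (Suc i)"
    if "(a, b) \<in> G (i, t)" "(i, t) \<in> ?J" for a b i t
    using that subdivision_bounds[of "c i" t "n i" "y i" b] c[of i] y_Suc[of i]
    by (auto simp: G_def grid_rect_def)
  have F_ex: "\<exists>t. (i, t) \<in> ?I \<and> (a, b) \<in> F (i, t)"
    if "1 \<le> i" "x i \<le> a" "a < x (Suc i)" "0 \<le> b" "b < y i" for a b i
    using that subdivision_ex[of "d i" "x i" a "m i"] d[of i] x_Suc[of i]
    by (auto simp: F_def grid_rect_def)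
  have G_ex: "\<exists>t. (i, t) \<in> ?J \<and> (a, b) \<in> G (i, t)"
    if "0 \<le> a" "a < x (Suc i)" "y i \<le> b" "b < y (Suc i)" for a b i
    using that subdivision_ex[of "c i" "y i" b "n i"] c[of i] y_Suc[of i]
    by (auto simp: G_def grid_rect_def)
  \<comment> \<open>Let \<open>b\<close> lie at level \<open>j\<close> of \<open>y\<close>. If
    \<open>a < x (Suc j)\<close>, the point is in a top strip; otherwise \<open>a\<close> lies at a
    level \<open>i > j\<close> of \<open>x\<close>, and \<open>b < y (Suc j) \<le> y i\<close> puts
    it in a right strip. Heights below \<open>y 0\<close> are covered by right strips alone.\<close>
  have cover: "p \<in> (\<Union>i\<in>?I. F i) \<union> (\<Union>j\<in>?J. G j)" if p: "p \<in> ?X" for p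
  proof -
    obtain a b where ab: "p = (a, b)" by (cases p)
    with p have nonneg: "0 \<le> a" "0 \<le> b" and out: "x 1 \<le> a \<or> y 0 \<le> b" by auto
    show ?thesis
    proof (cases "y 0 \<le> b")
      case True
      then obtain j where j: "y j \<le> b" "b < y (Suc j)"
        using int_strict_mono_interval_ex[of 0 y b] y_less by auto
      show ?thesis
      proof (cases "a < x (Suc j)")
        case True
        with G_ex[OF nonneg(1) True j] show ?thesis unfolding ab by blast
      next
        case False
        then obtain i where i: "i \<ge> Suc j" "x i \<le> a" "a < x (Suc i)"
          using int_strict_mono_interval_ex[of "Suc j" x a] x_less by auto
        have "b < y i" using j y_mono[OF i(1)] by simp
        with F_ex[of i a b] i nonneg show ?thesis unfolding ab by auto
      qed
    next
      case False
      with out have "x 1 \<le> a" by simp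
      then obtain i where i: "i \<ge> 1" "x i \<le> a" "a < x (Suc i)"
        using int_strict_mono_interval_ex[of 1 x a] x_less by auto
      have "b < y i" using False y_mono[of 0 i] by simp
      with F_ex[OF i nonneg(2)] show ?thesis unfolding ab by blast
    qed
  qed
  have "(\<Union>i\<in>?I. F i) \<subseteq> ?X"
  proof
    fix p assume "p \<in> (\<Union>i\<in>?I. F i)"
    then obtain q where q: "q \<in> ?I" "p \<in> F q" by (rule UN_E)
    obtain a b i t where "p = (a, b)" "q = (i, t)" by (cases p, cases q)
    with q have *: "p = (a, b)" "(a, b) \<in> F (i, t)" "(i, t) \<in> ?I" by simp_all
    with F[of a b i t] have "x i \<le> a" "0 \<le> b" by auto
    moreover have "x 1 \<le> x i" using * x_mono by simp
    ultimately show "p \<in> ?X" using x1 * by auto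
  qed
  moreover have "(\<Union>j\<in>?J. G j) \<subseteq> ?X"
  proof
    fix p assume "p \<in> (\<Union>j\<in>?J. G j)"
    then obtain q where q: "q \<in> ?J" "p \<in> G q" by (rule UN_E)
    obtain a b i t where "p = (a, b)" "q = (i, t)" by (cases p, cases q)
    with q have *: "p = (a, b)" "(a, b) \<in> G (i, t)" "(i, t) \<in> ?J" by simp_all
    with G[of a b i t] have "y i \<le> b" "0 \<le> a" by auto
    moreover have "y 0 \<le> y i" using y_mono by simp
    ultimately show "p \<in> ?X" using y0 * by auto
  qed
  ultimately have "?X = (\<Union>i\<in>?I. F i) \<union> (\<Union>j\<in>?J. G j)"
    by (intro equalityI subsetI[OF cover] Un_least)
  moreover have "disjoint_family_on F ?I"
  proof -
    have "(i, t) = (j, s)" if "(i, t) \<in> ?I" "(j, s) \<in> ?I" "(a, b) \<in> F (i, t)" "(a, b) \<in> F (j, s)"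
      for i t j s a b
    proof -
      have ij: "1 \<le> i" "1 \<le> j" using that by auto
      from F[OF that(3,1)] F[OF that(4,2)]
      have "\<not> i < j" "\<not> j < i" using x_mono[of "Suc i" j] x_mono[of "Suc j" i] ij by auto
      hence "i = j" by simp
      with subdivision_unique[of "d i" "x i" t a s] that d ij show ?thesis
        by (auto simp: F_def grid_rect_def)
    qed
    thus ?thesis unfolding disjoint_family_on_def by fast
  qed
  moreover have "disjoint_family_on G ?J"
  proof -
    have "(i, t) = (j, s)" if "(i, t) \<in> ?J" "(j, s) \<in> ?J" "(a, b) \<in> G (i, t)" "(a, b) \<in> G (j, s)"
      for i t j s a b
    proof -
      from G[OF that(3,1)] G[OF that(4,2)]
      have "\<not> i < j" "\<not> j < i" using y_mono[of "Suc i" j] y_mono[of "Suc j" i] by auto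
      hence "i = j" by simp
      with subdivision_unique[of "c i" "y i" t b s] that c show ?thesis
        by (auto simp: G_def grid_rect_def)
    qed
    thus ?thesis unfolding disjoint_family_on_def by fast
  qed
  moreover have "(\<Union>i\<in>?I. F i) \<inter> (\<Union>j\<in>?J. G j) = {}"
  proof -
    have False if "(i, t) \<in> ?I" "(j, s) \<in> ?J" "(a, b) \<in> F (i, t)" "(a, b) \<in> G (j, s)"
      for i t j s a b
    proof -
      from F[OF that(3,1)] G[OF that(4,2)]
      have *: "x i \<le> a" "b < y i" "a < x (Suc j)" "y j \<le> b" by auto
      \<comment> \<open>The first coordinate forces \<open>i \<le> j\<close>, the second one
        \<open>j < i\<close>.\<close>
      have "\<not> Suc j \<le> i" using x_mono[of "Suc j" i] * by auto
      moreover have "\<not> i \<le> j" using y_mono[of i j] * by auto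
      ultimately show False by simp
    qed
    thus ?thesis by fast
  qed
  ultimately show ?thesis unfolding is_disjoint_union2_def by (intro conjI)
qed

section \<open>Application to the convergents of the quotient of the logarithms\<close>

theorem mainTheorem1:
  fixes p1 p2 :: nat and \<alpha> :: real and a h k :: "nat \<Rightarrow> int"
  assumes "0 < p1" and "p1 < p2"
    and "\<alpha> = ln (real p1) / ln (real p2)" and "\<alpha> \<notin> \<rat>"
    and "simple_cf_expansion \<alpha> a"
    and "primary_convergents a h k"
  shows
    "(\<forall>i t. 1 \<le> i \<and> 0 \<le> t \<and> t < a (2*i+1) \<longrightarrow>
        has_dims (rectA h k i t) (h (2*i)) (k (2*i)) \<and>
        has_dims (rectA_tilde h k i t) (h (2*i)) (k (2*i)) \<and>
        rectA_tilde h k i t =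
          translate (rectA h k i t) (- k (2*i-1) - t * k (2*i), h (2*i-1) + t * h (2*i)) \<and>
        (\<forall>v \<in> rectA h k i t. \<exists>m n. is_coords p1 p2 v m \<and> next_in (numS p1 p2) m n \<and>
           is_coords p1 p2 (v + (- k (2*i-1) - t * k (2*i), h (2*i-1) + t * h (2*i))) n))
   \<and> (\<forall>i t. 0 \<le> t \<and> t < a (2*i+2) \<longrightarrow>
        has_dims (rectP h k i t) (h (2*i+1)) (k (2*i+1)) \<and>
        has_dims (rectP_tilde h k i t) (h (2*i+1)) (k (2*i+1)) \<and>
        rectP_tilde h k i t =
          translate (rectP h k i t) (k (2*i) + t * k (2*i+1), - h (2*i) - t * h (2*i+1)) \<and>
        (\<forall>v \<in> rectP h k i t. \<exists>m n. is_coords p1 p2 v m \<and> next_in (numS p1 p2) m n \<and>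
           is_coords p1 p2 (v + (k (2*i) + t * k (2*i+1), - h (2*i) - t * h (2*i+1))) n))
   \<and> is_disjoint_union2 ({0..} \<times> {0..})
        (indexA a) (\<lambda>(i, t). rectA h k i t) (indexP a) (\<lambda>(i, t). rectP h k i t)
   \<and> is_disjoint_union2 ({0..} \<times> {0..} - {(0, 0)})
        (indexA a) (\<lambda>(i, t). rectA_tilde h k i t) (indexP a) (\<lambda>(i, t). rectP_tilde h k i t)"
proof -
  from assms(5) have a0: "a 0 = 0" and a: "\<And>i. i \<ge> 1 \<Longrightarrow> a i \<ge> 1"
    and lim: "fin_cf a \<longlonglongrightarrow> \<alpha>"
    by (auto simp: simple_cf_expansion_def)
  note hk = primary_convergents_eq_cf[OF assms(5,6)]
  have k_pos: "k n > 0" for n using cf_den_pos[OF a] by (simp add: hk)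
  have h_rec: "h (Suc (Suc n)) = h n + a (Suc (Suc n)) * h (Suc n)"
    and k_rec: "k (Suc (Suc n)) = k n + a (Suc (Suc n)) * k (Suc n)" for n
    by (simp_all add: hk)
  have h0: "h 0 = 0" and h1: "h 1 = 1" and k0: "k 0 = 1" by (simp_all add: hk a0)
  have h_pos_Suc: "h (Suc n) > 0" for n
  proof -
    \<comment> \<open>The recurrence looks back two terms, so two neighbours are carried along,
      starting after \<open>h 0 = 0\<close>.\<close>
    have "h (Suc n) > 0 \<and> h (Suc (Suc n)) > 0"
    proof (induction n)
      case 0
      show ?case using h0 h1 a[of 2] h_rec[of 0] by (simp add: numeral_2_eq_2)
    next
      case (Suc n)
      thus ?case using h_rec[of "Suc n"] a[of "Suc (Suc (Suc n))"] by (simp add: add_pos_pos)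
    qed
    thus ?thesis ..
  qed
  have h_pos: "h n > 0" if "n \<ge> 1" for n using h_pos_Suc[of "n - 1"] that by simp
  have h_nonneg: "h n \<ge> 0" for n using h_pos[of n] h0 by (cases "n = 0") auto
  have det: "h (Suc n) * k n - h n * k (Suc n) = (-1) ^ n" for n
    unfolding hk by (rule cf_det)

  \<comment> \<open>Otherwise \<alpha> would be 0, hence rational.\<close>
  have "p1 \<noteq> 1" using assms(3,4) by auto
  hence p: "1 < p1" "1 < p2" using assms(1,2) by auto
  hence ln2: "ln (real p2) > 0" by simp
  have ln1: "ln (real p1) = \<alpha> * ln (real p2)" using ln2 assms(3) by simp
  have even: "of_int (h (2*n)) * ln (real p2) < of_int (k (2*n)) * ln (real p1)" for n
    using mult_strict_right_mono[OF cf_even_below_odd_above(1)[OF a lim, of n] ln2]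
    unfolding ln1 hk by (simp add: mult_ac)
  have odd: "of_int (k (2*n+1)) * ln (real p1) < of_int (h (2*n+1)) * ln (real p2)" for n
    using mult_strict_right_mono[OF cf_even_below_odd_above(2)[OF a lim, of n] ln2]
    unfolding ln1 hk by (simp add: mult_ac)

  have A: "has_dims (rectA h k i t) (h (2*i)) (k (2*i)) \<and>
        has_dims (rectA_tilde h k i t) (h (2*i)) (k (2*i)) \<and>
        rectA_tilde h k i t =
          translate (rectA h k i t) (- k (2*i-1) - t * k (2*i), h (2*i-1) + t * h (2*i)) \<and>
        (\<forall>v \<in> rectA h k i t. \<exists>m n. is_coords p1 p2 v m \<and> next_in (numS p1 p2) m n \<and>
           is_coords p1 p2 (v + (- k (2*i-1) - t * k (2*i), h (2*i-1) + t * h (2*i))) n)"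
    if i: "1 \<le> i" and t: "0 \<le> t" "t < a (2*i+1)" for i t
  proof (intro conjI ballI)
    obtain j where j: "i = Suc j" using i by (cases i) auto
    show "has_dims (rectA h k i t) (h (2*i)) (k (2*i))"
      "has_dims (rectA_tilde h k i t) (h (2*i)) (k (2*i))"
      using h_pos[of "2*i"] k_pos[of "2*i"] i unfolding rectA_def rectA_tilde_def
      by (auto intro!: has_dims_grid_rect simp: algebra_simps)
    show "rectA_tilde h k i t =
          translate (rectA h k i t) (- k (2*i-1) - t * k (2*i), h (2*i-1) + t * h (2*i))"
      unfolding rectA_def rectA_tilde_def translate_grid_rect by (simp add: algebra_simps)
    fix v assume v: "v \<in> rectA h k i t"
    obtain x y where xy: "v = (x, y)" by (cases v)
    define K where "K = k (2*i-1) + t * k (2*i)"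
    define H where "H = h (2*i-1) + t * h (2*i)"
    have "\<exists>m n. is_coords p1 p2 (x, y) m \<and> next_in (numS p1 p2) m n \<and>
           is_coords p1 p2 (x - K, y + H) n"
    proof (rule next_in_numS_translate[OF p])
      \<comment> \<open>The terms with \<open>t\<close> cancel, leaving the determinant at the odd
        index \<open>2*i-1\<close> with its sign reversed.\<close>
      show "H * k (2*i) - h (2*i) * K = 1"
        using det[of "2*i-1"] i unfolding H_def K_def j by (simp add: algebra_simps)
      show "0 \<le> H" "0 \<le> K" "0 \<le> h (2*i)" "0 \<le> k (2*i)"
        using h_nonneg k_pos t by (auto simp: H_def K_def less_imp_le)
      show "K \<le> x" "x < K + k (2*i)" "0 \<le> y" "y < h (2*i)"
        using v xy by (auto simp: rectA_def grid_rect_def K_def algebra_simps)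
      show "of_int (h (2*i)) * ln (real p2) < of_int (k (2*i)) * ln (real p1)" by (rule even)
      \<comment> \<open>\<open>(K, -H)\<close> is \<open>(k (2*i+1), - h (2*i+1))\<close> minus a
        nonnegative multiple of \<open>(k (2*i), - h (2*i))\<close>. The form is negative on the
        former and positive on the latter, hence negative on \<open>(K, -H)\<close>.\<close>
      have Kr: "k (2*i+1) = K + (a (2*i+1) - t) * k (2*i)"
        using k_rec[of "2*i-1"] i unfolding K_def j by (simp add: algebra_simps)
      have Hr: "h (2*i+1) = H + (a (2*i+1) - t) * h (2*i)"
        using h_rec[of "2*i-1"] i unfolding H_def j by (simp add: algebra_simps)
      have "0 \<le> of_int (a (2*i+1) - t) *
          (of_int (k (2*i)) * ln (real p1) - of_int (h (2*i)) * ln (real p2))"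
        using t even[of i] by (intro mult_nonneg_nonneg) auto
      with odd[of i] show "of_int K * ln (real p1) < of_int H * ln (real p2)"
        unfolding Kr Hr by (simp add: algebra_simps)
    qed
    thus "\<exists>m n. is_coords p1 p2 v m \<and> next_in (numS p1 p2) m n \<and>
           is_coords p1 p2 (v + (- k (2*i-1) - t * k (2*i), h (2*i-1) + t * h (2*i))) n"
      unfolding xy by (simp add: K_def H_def algebra_simps)
  qed

  have P: "has_dims (rectP h k i t) (h (2*i+1)) (k (2*i+1)) \<and>
        has_dims (rectP_tilde h k i t) (h (2*i+1)) (k (2*i+1)) \<and>
        rectP_tilde h k i t =
          translate (rectP h k i t) (k (2*i) + t * k (2*i+1), - h (2*i) - t * h (2*i+1)) \<and>
        (\<forall>v \<in> rectP h k i t. \<exists>m n. is_coords p1 p2 v m \<and> next_in (numS p1 p2) m n \<and>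
           is_coords p1 p2 (v + (k (2*i) + t * k (2*i+1), - h (2*i) - t * h (2*i+1))) n)"
    if t: "0 \<le> t" "t < a (2*i+2)" for i t
  proof (intro conjI ballI)
    show "has_dims (rectP h k i t) (h (2*i+1)) (k (2*i+1))"
      "has_dims (rectP_tilde h k i t) (h (2*i+1)) (k (2*i+1))"
      using h_pos[of "2*i+1"] k_pos[of "2*i+1"] unfolding rectP_def rectP_tilde_def
      by (auto intro!: has_dims_grid_rect simp: algebra_simps)
    show "rectP_tilde h k i t =
          translate (rectP h k i t) (k (2*i) + t * k (2*i+1), - h (2*i) - t * h (2*i+1))"
      unfolding rectP_def rectP_tilde_def translate_grid_rect by (simp add: algebra_simps)
    fix v assume v: "v \<in> rectP h k i t"
    obtain x y where xy: "v = (x, y)" by (cases v)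
    define K where "K = k (2*i) + t * k (2*i+1)"
    define H where "H = h (2*i) + t * h (2*i+1)"
    \<comment> \<open>Mirror image of the previous case: exchanging the bases and the coordinates
      swaps the roles of \<open>h\<close> and \<open>k\<close>, and of even and odd indices.\<close>
    have "\<exists>m n. is_coords p2 p1 (y, x) m \<and> next_in (numS p2 p1) m n \<and>
           is_coords p2 p1 (y - H, x + K) n"
    proof (rule next_in_numS_translate[OF p(2,1)])
      show "K * h (2*i+1) - k (2*i+1) * H = 1"
        using det[of "2*i"] unfolding H_def K_def by (simp add: algebra_simps)
      show "0 \<le> K" "0 \<le> H" "0 \<le> k (2*i+1)" "0 \<le> h (2*i+1)"
        using h_nonneg k_pos t by (auto simp: H_def K_def less_imp_le)
      show "H \<le> y" "y < H + h (2*i+1)" "0 \<le> x" "x < k (2*i+1)"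
        using v xy by (auto simp: rectP_def grid_rect_def H_def algebra_simps)
      show "of_int (k (2*i+1)) * ln (real p1) < of_int (h (2*i+1)) * ln (real p2)" by (rule odd)
      have Kr: "k (2 * Suc i) = K + (a (2*i+2) - t) * k (2*i+1)"
        using k_rec[of "2*i"] unfolding K_def by (simp add: algebra_simps)
      have Hr: "h (2 * Suc i) = H + (a (2*i+2) - t) * h (2*i+1)"
        using h_rec[of "2*i"] unfolding H_def by (simp add: algebra_simps)
      have "0 \<le> of_int (a (2*i+2) - t) *
          (of_int (h (2*i+1)) * ln (real p2) - of_int (k (2*i+1)) * ln (real p1))"
        using t odd[of i] by (intro mult_nonneg_nonneg) auto
      with even[of "Suc i"] show "of_int H * ln (real p2) < of_int K * ln (real p1)"
        unfolding Kr Hr by (simp add: algebra_simps)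
    qed
    thus "\<exists>m n. is_coords p1 p2 v m \<and> next_in (numS p1 p2) m n \<and>
           is_coords p1 p2 (v + (k (2*i) + t * k (2*i+1), - h (2*i) - t * h (2*i+1))) n"
      unfolding xy is_coords_swap numS_commute[of p2 p1]
      by (simp add: K_def H_def algebra_simps)
  qed

  have a_pos: "0 < a (Suc n)" for n using a[of "Suc n"] by simp
  have odd_rec: "k (2 * Suc i - 1) = k (2*i-1) + a (2*i+1) * k (2*i)"
    "h (2 * Suc i - 1) = h (2*i-1) + a (2*i+1) * h (2*i)" if "i \<ge> 1" for i
    using that k_rec[of "2*i-1"] h_rec[of "2*i-1"] by (auto simp: Suc_diff_Suc)
  have even_rec: "k (2 * Suc i) = k (2*i) + a (2*i+2) * k (2*i+1)"
    "h (2 * Suc i) = h (2*i) + a (2*i+2) * h (2*i+1)" for i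
    using k_rec[of "2*i"] h_rec[of "2*i"] by auto

  \<comment> \<open>Here the initial block of the staircase is empty because
    \<open>h 0 = 0\<close>.\<close>
  have tiling: "is_disjoint_union2 ({0..} \<times> {0..})
        (indexA a) (\<lambda>(i, t). rectA h k i t) (indexP a) (\<lambda>(i, t). rectP h k i t)"
    using staircase_tiling[of "\<lambda>i. h (2*i+1)" "\<lambda>i. k (2*i)" "\<lambda>i. a (2*i+1)" "\<lambda>i. a (2*i+2)"
        "\<lambda>i. k (2*i-1)" "\<lambda>i. h (2*i)"]
      odd_rec even_rec h_pos k_pos less_imp_le[OF k_pos] a_pos h0
    by (simp add: indexA_def indexP_def rectA_def rectP_def)

  \<comment> \<open>The translated rectangles, reflected in the diagonal, form a staircase with
    \<open>h\<close> and \<open>k\<close> exchanged. Its initial block is the origin alone, since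
    \<open>h 1 = k 0 = 1\<close>.\<close>
  have "is_disjoint_union2 ({0..} \<times> {0..} - {0..<h 1} \<times> {0..<k 0})
        (indexA a)
        (\<lambda>(i, t). grid_rect (h (2*i-1) + t * h (2*i)) (h (2*i-1) + (t+1) * h (2*i) - 1) 0 (k (2*i) - 1))
        (indexP a)
        (\<lambda>(i, t). grid_rect 0 (h (2*i+1) - 1) (k (2*i) + t * k (2*i+1)) (k (2*i) + (t+1) * k (2*i+1) - 1))"
    using staircase_tiling[of "\<lambda>i. k (2*i+1)" "\<lambda>i. h (2*i)" "\<lambda>i. a (2*i+1)" "\<lambda>i. a (2*i+2)"
        "\<lambda>i. h (2*i-1)" "\<lambda>i. k (2*i)"]
      odd_rec even_rec h_pos k_pos less_imp_le[OF k_pos] a_pos h_nonneg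
    by (simp add: indexA_def indexP_def)
  from is_disjoint_union2_image[OF this inj_swap]
  have tiling': "is_disjoint_union2 ({0..} \<times> {0..} - {(0, 0)})
        (indexA a) (\<lambda>(i, t). rectA_tilde h k i t) (indexP a) (\<lambda>(i, t). rectP_tilde h k i t)"
  proof (rule iffD1[OF is_disjoint_union2_cong, rotated -1])
    show "prod.swap ` ({0..} \<times> {0..} - {0..<h 1} \<times> {0..<k 0}) = {0..} \<times> {0..} - {(0, 0)}"
      unfolding image_set_diff[OF inj_swap] product_swap unfolding h1 k0 by auto
  qed (simp_all add: rectA_tilde_def rectP_tilde_def swap_grid_rect case_prod_beta)

  from A P tiling tiling' show ?thesis by blast
qed

end
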